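(* Let $n=2^\ell$ with $\ell\ge 2$ an integer, and consider a knockout tournament with $n$ players of equal strength (i.e. $p_{ij}=1/2$ for all $i\neq j$) in which the schedule of matches is deterministic. Let $S_i$ be the number of games won by player $i\in\{1,\dots,n\}$. Then the random vector $\boldsymbol S=(S_1,\dots,S_n)$ is negatively right-tail dependent (NRTD).
   Context: Notation: $[n]=\{1,\dots,n\}$; for $J\subset[n]$, $\boldsymbol X_J=(X_j)_{j\in J}$, and inequalities between vectors are componentwise. "Increasing" is in the weak sense. $[\boldsymbol X\mid A]$ denotes any random vector whose distribution is the conditional distribution of $\boldsymbol X$ given the event $A$; whenever it is written, it is assumed that $\mathbb P(A)>0$. Usual stochastic order: $\boldsymbol X\le_{\rm st}\boldsymbol Y$ if $\mathbb E[\varphi(\boldsymbol X)]\le\mathbb E[\varphi(\boldsymbol Y)]$ for all (coordinatewise) increasing real functions $\varphi$ for which the expectations exist. A random vector $\boldsymbol X=(X_1,\dots,X_n)$ is NRTD if $[\boldsymbol X_I\mid\boldsymbol X_J>\boldsymbol x_J]\ge_{\rm st}[\boldsymbol X_I\mid\boldsymbol X_J>\boldsymbol x_J^*]$ for all disjoint subsets $I,J\subset[n]$ and all $\boldsymbol x_J\le\boldsymbol x_J^*$ (for which the conditioning events have positive probability). Knockout tournament with $n=2^\ell$ players: whenever players $i\ne j$ meet, player $i$ defeats player $j$ with probability $p_{ij}$ (and $p_{ji}=1-p_{ij}$), independently of all other duels. The winners of one round move to the next round and the defeated players are eliminated; the tournament continues until only one player remains. Deterministic schedule (non-random draw): the bracket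 is fixed in advance, i.e. the players are placed by a fixed bijection at positions $1,\dots,2^\ell$, and in round $k\in\{1,\dots,\ell\}$, for each $m\in\{1,\dots,2^{\ell-k}\}$, the surviving player among positions $(m-1)2^k+1,\dots,(m-1)2^k+2^{k-1}$ plays against the surviving player among positions $(m-1)2^k+2^{k-1}+1,\dots,m2^k$. *)

theory Defs
  imports "HOL-Probability.Probability"
begin

section \<open>Stochastic order and negative right-tail dependence\<close>

text \<open>
  A random vector indexed by \<open>I\<close> is a family \<open>X i\<close> (\<open>i \<in> I\<close>) of real random variables; its law lives
  on \<open>PiM I (\<lambda>_. borel)\<close>, whose points are the functions in \<open>I \<rightarrow>\<^sub>E UNIV\<close>.  On that set the order of
  functions is the componentwise order over \<open>I\<close>, because all members agree outside \<open>I\<close>.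
\<close>

definition st_le :: "'i set \<Rightarrow> ('i \<Rightarrow> real) measure \<Rightarrow> ('i \<Rightarrow> real) measure \<Rightarrow> bool" where
  "st_le I P Q \<longleftrightarrow>
     (\<forall>\<phi> :: ('i \<Rightarrow> real) \<Rightarrow> real.
        mono_on (I \<rightarrow>\<^sub>E UNIV) \<phi> \<longrightarrow> integrable P \<phi> \<longrightarrow> integrable Q \<phi> \<longrightarrow>
        integral\<^sup>L P \<phi> \<le> integral\<^sup>L Q \<phi>)"

definition cond_law :: "'a measure \<Rightarrow> 'a set \<Rightarrow> 'i set \<Rightarrow> ('i \<Rightarrow> 'a \<Rightarrow> real) \<Rightarrow> ('i \<Rightarrow> real) measure" where
  "cond_law M A I X = distr (uniform_measure M A) (PiM I (\<lambda>_. borel)) (\<lambda>\<omega>. \<lambda>i\<in>I. X i \<omega>)"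

definition exceed :: "'a measure \<Rightarrow> 'i set \<Rightarrow> ('i \<Rightarrow> 'a \<Rightarrow> real) \<Rightarrow> ('i \<Rightarrow> real) \<Rightarrow> 'a set" where
  "exceed M J X x = {\<omega> \<in> space M. \<forall>j\<in>J. X j \<omega> > x j}"

definition NRTD :: "'a measure \<Rightarrow> 'i set \<Rightarrow> ('i \<Rightarrow> 'a \<Rightarrow> real) \<Rightarrow> bool" where
  "NRTD M N X \<longleftrightarrow>
     (\<forall>i\<in>N. X i \<in> borel_measurable M) \<and>
     (\<forall>I J x x'. I \<subseteq> N \<longrightarrow> J \<subseteq> N \<longrightarrow> I \<inter> J = {} \<longrightarrow> (\<forall>j\<in>J. x j \<le> x' j) \<longrightarrow>
        measure M (exceed M J X x) > 0 \<longrightarrow> measure M (exceed M J X x') > 0 \<longrightarrow>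
        st_le I (cond_law M (exceed M J X x') I X) (cond_law M (exceed M J X x) I X))"

section \<open>Knockout tournaments\<close>

text \<open>
  \<open>seat q\<close> is the player placed at position \<open>q\<close>, and \<open>b i j\<close> says that \<open>i\<close> defeats \<open>j\<close> if they meet.
  \<open>survivor seat b k m\<close> is the player left after round \<open>k\<close> among the positions
  \<open>(m - 1) * 2 ^ k + 1, \<dots>, m * 2 ^ k\<close>, hence for \<open>k \<ge> 1\<close> the winner of match \<open>m\<close> of round \<open>k\<close>.
  The two halves of that block are the blocks \<open>2 * m - 1\<close> and \<open>2 * m\<close> of the preceding round.
\<close>

primrec survivor :: "(nat \<Rightarrow> nat) \<Rightarrow> (nat \<Rightarrow> nat \<Rightarrow> bool) \<Rightarrow> nat \<Rightarrow> nat \<Rightarrow> nat" where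
  "survivor seat b 0 m = seat m"
| "survivor seat b (Suc k) m =
     (let i = survivor seat b k (2 * m - 1); j = survivor seat b k (2 * m)
      in if b i j then i else j)"

definition games_won :: "nat \<Rightarrow> (nat \<Rightarrow> nat) \<Rightarrow> (nat \<Rightarrow> nat \<Rightarrow> bool) \<Rightarrow> nat \<Rightarrow> nat" where
  "games_won l seat b i =
     card {(k, m). k \<in> {1..l} \<and> m \<in> {1..2 ^ (l - k)} \<and> survivor seat b k m = i}"

text \<open>
  Two players meet at most once, so a duel is identified with an unordered pair of players, represented
  by \<open>(i, j)\<close> with \<open>i < j\<close>.  Outcomes are attached to all pairs; only those of the pairs that actually
  meet affect the tournament.
\<close>

locale knockout_tournament = prob_space M
  for M :: "'a measure" +
  fixes l :: nat
    and p :: "nat \<Rightarrow> nat \<Rightarrow> real"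
    and seat :: "nat \<Rightarrow> nat"
    and beats :: "'a \<Rightarrow> nat \<Rightarrow> nat \<Rightarrow> bool"
  assumes seat_bij: "bij_betw seat {1..2 ^ l} {1..2 ^ l}"
    and beats_swap: "\<And>\<omega> i j. \<lbrakk>\<omega> \<in> space M; i \<in> {1..2 ^ l}; j \<in> {1..2 ^ l}; i \<noteq> j\<rbrakk>
      \<Longrightarrow> beats \<omega> j i \<longleftrightarrow> \<not> beats \<omega> i j"
    and beats_prob: "\<And>i j. \<lbrakk>i \<in> {1..2 ^ l}; j \<in> {1..2 ^ l}; i \<noteq> j\<rbrakk>
      \<Longrightarrow> prob {\<omega> \<in> space M. beats \<omega> i j} = p i j"
    and beats_indep: "indep_vars (\<lambda>_. count_space UNIV) (\<lambda>(i, j) \<omega>. beats \<omega> i j)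
      {(i, j). 1 \<le> i \<and> i < j \<and> j \<le> 2 ^ l}"

end

theory Submission
  imports Defs
begin

text \<open>
  A condition \<open>S\<^sub>j > x\<^sub>j\<close> says that player \<open>j\<close> wins his first \<open>t\<^sub>j\<close> matches, where \<open>t\<^sub>j\<close> is the
  least natural number exceeding \<open>x\<^sub>j\<close>.  Raising the thresholds one win at a time, it is enough to compare the
  conditions given by \<open>t\<close> and by \<open>t'\<close>, where \<open>t'\<close> requires one further win \<open>t\<^sub>j + 1\<close> of a single
  player \<open>j \<in> J\<close>.  Let \<open>v\<close> be the match of round \<open>t\<^sub>j + 1\<close> above the seat of \<open>j\<close>.

  Under \<open>t\<close>, player \<open>j\<close> takes part in \<open>v\<close> and the condition \<open>t'\<close> says that he wins it.
  Since all duels are fair, the outcome table is uniformly distributed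
  (\<open>result_law\<close>), so that conditional expectations are averages over finite sets of tables.  Now reverse
  the match \<open>v\<close> and let its new winner \<open>w\<close> take over all later results of the old one
  (\<open>reverse_match\<close>).  This is an involution on tables.  It exchanges the tables that satisfy \<open>t'\<close> with
  those that satisfy \<open>t\<close> but not \<open>t'\<close> (\<open>bij_betw_reverse_match\<close>): it lowers the score of \<open>j\<close>, raises
  the score of \<open>w\<close> and leaves all others alone, and no requirement on \<open>w\<close> is lost in the opposite direction,
  since otherwise both \<open>j\<close> and \<open>w\<close> would have to win \<open>v\<close> under \<open>t'\<close>, which has positive
  probability.  Hence, for \<open>j \<notin> I\<close> and \<open>\<phi>\<close> increasing, the average of \<open>\<phi>(S\<^sub>I)\<close> over the tables with \<open>t\<close> but
  not \<open>t'\<close> is at least the average over those with \<open>t'\<close> (\<open>games_won_reverse_match_ge\<close>), and therefore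
  so is the average over all tables with \<open>t\<close> (\<open>average_outcomes_step\<close>).
\<close>

section \<open>Brackets and outcome tables\<close>

text \<open>A fixed draw for \<open>2 ^ l\<close> players, without any assumption on the results of the duels.\<close>

locale bracket =
  fixes l :: nat and seat :: "nat \<Rightarrow> nat"
  assumes seat_bij: "bij_betw seat {1..2 ^ l} {1..2 ^ l}"
begin

abbreviation players :: "nat set" where
  "players \<equiv> {1..2 ^ l}"

text \<open>
  The number of the block of \<open>2 ^ k\<close> consecutive positions in which player \<open>i\<close> is seated; blocks are
  numbered from \<open>1\<close>, as in \<open>survivor\<close>.
\<close>

definition block :: "nat \<Rightarrow> nat \<Rightarrow> nat" where
  "block k i = (inv_into players seat i - 1) div 2 ^ k + 1"

lemma block_Suc: "block (Suc k) i = (block k i - 1) div 2 + 1"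
  by (simp add: block_def div_mult2_eq[symmetric] mult.commute)

lemma block_Suc_eqI:
  assumes "m \<ge> 1" "block k i = 2 * m - 1 \<or> block k i = 2 * m"
  shows "block (Suc k) i = m"
  using assms unfolding block_Suc by presburger

lemma block_mono_eq:
  assumes "block k i = block k j" "k \<le> k'"
  shows "block k' i = block k' j"
  using assms(2,1) by (induction rule: dec_induct) (simp_all add: block_Suc)

lemma block_in_range:
  assumes "i \<in> players" "k \<le> l"
  shows "block k i \<in> {1..2 ^ (l - k)}"
proof -
  have "inv_into players seat i \<in> players"
    using seat_bij assms(1) by (metis bij_betw_def inv_into_into)
  then have "inv_into players seat i - 1 < 2 ^ (l - k) * 2 ^ k"
    using assms(2) by (auto simp flip: power_add)
  then have "(inv_into players seat i - 1) div 2 ^ k < 2 ^ (l - k)"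
    by (simp add: less_mult_imp_div_less)
  then show ?thesis
    by (simp add: block_def)
qed

lemma children_in_range:
  fixes m :: nat
  assumes "Suc k \<le> l" "m \<in> {1..2 ^ (l - Suc k)}"
  shows "2 * m - 1 \<in> {1..2 ^ (l - k)}" "2 * m \<in> {1..2 ^ (l - k)}"
proof -
  have "l - k = Suc (l - Suc k)"
    using assms(1) by simp
  then have "(2::nat) ^ (l - k) = 2 * 2 ^ (l - Suc k)"
    by simp
  then show "2 * m - 1 \<in> {1..2 ^ (l - k)}" "2 * m \<in> {1..2 ^ (l - k)}"
    using assms(2) by auto
qed

lemma survivor_in_block:
  assumes "k \<le> l" "m \<in> {1..2 ^ (l - k)}"
  shows "survivor seat b k m \<in> players \<and> block k (survivor seat b k m) = m"
  using assms
proof (induction k arbitrary: m)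
  case 0
  then have "seat m \<in> players" "inv_into players seat (seat m) = m"
    using seat_bij by (auto simp: bij_betw_def inv_into_f_f)
  with 0 show ?case
    by (simp add: block_def)
next
  case (Suc k)
  note r = children_in_range[OF Suc.prems]
  have "m \<ge> 1"
    using Suc.prems by simp
  then have "(2 * m - 1 - 1) div 2 + 1 = m" "(2 * m - 1) div 2 + 1 = m"
    by presburger+
  then show ?case
    using Suc.IH[OF _ r(1)] Suc.IH[OF _ r(2)] Suc.prems
    by (auto simp: Let_def block_Suc)
qed

lemmas survivor_in_players = survivor_in_block[THEN conjunct1]
lemmas block_survivor = survivor_in_block[THEN conjunct2]

lemma siblings_distinct:
  assumes "Suc k \<le> l" "m \<in> {1..2 ^ (l - Suc k)}"
  shows "block k (survivor seat b k (2 * m - 1)) \<noteq> block k (survivor seat b k (2 * m))"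
  using children_in_range[OF assms] assms by (auto simp: block_survivor)

lemma survivor_cong:
  assumes "\<And>a c. a \<in> players \<Longrightarrow> c \<in> players \<Longrightarrow> a \<noteq> c \<Longrightarrow> b a c = b' a c"
    and "k \<le> l" "m \<in> {1..2 ^ (l - k)}"
  shows "survivor seat b k m = survivor seat b' k m"
  using assms(2,3)
proof (induction k arbitrary: m)
  case (Suc k)
  note r = children_in_range[OF Suc.prems]
  have k: "k \<le> l"
    using Suc.prems by simp
  have "b (survivor seat b k (2 * m - 1)) (survivor seat b k (2 * m)) =
      b' (survivor seat b k (2 * m - 1)) (survivor seat b k (2 * m))"
    by (rule assms(1)[OF survivor_in_players[OF k r(1)] survivor_in_players[OF k r(2)]])
      (use siblings_distinct[OF Suc.prems] in metis)
  then show ?case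
    using Suc.IH[OF k r(1)] Suc.IH[OF k r(2)] by (simp add: Let_def)
qed simp

text \<open>Player \<open>i\<close> is still in the tournament after round \<open>k\<close>.\<close>

definition survives :: "(nat \<Rightarrow> nat \<Rightarrow> bool) \<Rightarrow> nat \<Rightarrow> nat \<Rightarrow> bool" where
  "survives b k i \<longleftrightarrow> survivor seat b k (block k i) = i"

lemma survives_0: "i \<in> players \<Longrightarrow> survives b 0 i"
  using seat_bij survivor_in_block[of 0] bij_betw_inv_into_right[OF seat_bij, of i]
    inv_into_into[of i seat players]
  by (auto simp: survives_def block_def bij_betw_def)

lemma block_children:
  "block k i = 2 * block (Suc k) i - 1 \<or> block k i = 2 * block (Suc k) i"
proof -
  have "block k i \<ge> 1"
    by (simp add: block_def)
  then show ?thesis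
    unfolding block_Suc by presburger
qed

lemma survives_Suc_imp:
  assumes "survives b (Suc k) i" "Suc k \<le> l" "i \<in> players"
  shows "survives b k i"
proof -
  let ?m = "block (Suc k) i"
  have m: "?m \<in> {1..2 ^ (l - Suc k)}"
    using block_in_range assms by blast
  note r = children_in_range[OF assms(2) m]
  have "i = survivor seat b k (2 * ?m - 1) \<or> i = survivor seat b k (2 * ?m)"
    using assms(1) by (auto simp: survives_def Let_def split: if_splits)
  then show ?thesis
    using block_survivor[OF _ r(1), of b] block_survivor[OF _ r(2), of b] assms(2)
    unfolding survives_def by (metis Suc_leD)
qed

lemma survives_antimono:
  assumes "survives b k' i" "k \<le> k'" "k' \<le> l" "i \<in> players"
  shows "survives b k i"
  using assms(2,1,3)
  by (induction rule: dec_induct) (use assms(4) survives_Suc_imp in auto)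

lemma games_won_eq_card:
  assumes "i \<in> players"
  shows "games_won l seat b i = card {k \<in> {1..l}. survives b k i}"
proof -
  have "bij_betw fst {(k, m). k \<in> {1..l} \<and> m \<in> {1..2 ^ (l - k)} \<and> survivor seat b k m = i}
      {k \<in> {1..l}. survives b k i}"
  proof (rule bij_betwI[where g = "\<lambda>k. (k, block k i)"])
    show "fst \<in> {(k, m). k \<in> {1..l} \<and> m \<in> {1..2 ^ (l - k)} \<and> survivor seat b k m = i} \<rightarrow>
        {k \<in> {1..l}. survives b k i}"
      using block_survivor by (fastforce simp: survives_def)
    show "(\<lambda>k. (k, block k i)) \<in> {k \<in> {1..l}. survives b k i} \<rightarrow>
        {(k, m). k \<in> {1..l} \<and> m \<in> {1..2 ^ (l - k)} \<and> survivor seat b k m = i}"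
      using block_in_range[OF assms] by (auto simp: survives_def)
  qed (use block_survivor in fastforce)+
  then show ?thesis
    unfolding games_won_def by (rule bij_betw_same_card)
qed

text \<open>
  A player still in the tournament after round \<open>k\<close> is the winner of his match in each of the first \<open>k\<close>
  rounds, so the rounds that he survives form an initial segment of \<open>{1..l}\<close>.
\<close>

lemma le_games_won_iff:
  assumes "i \<in> players"
  shows "t \<le> games_won l seat b i \<longleftrightarrow> t \<le> l \<and> survives b t i"
proof
  assume t: "t \<le> games_won l seat b i"
  show "t \<le> l \<and> survives b t i"
  proof (rule ccontr)
    assume neg: "\<not> (t \<le> l \<and> survives b t i)"
    have "t > 0"
      using neg survives_0[OF assms] by (cases t) auto
    have "{k \<in> {1..l}. survives b k i} \<subseteq> {1..<t} \<inter> {1..l}"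
      using neg survives_antimono[OF _ _ _ assms] by (auto simp: not_le[symmetric])
    then have "games_won l seat b i \<le> card ({1..<t} \<inter> {1..l})"
      unfolding games_won_eq_card[OF assms] by (intro card_mono) auto
    also have "\<dots> \<le> card {1..<t}"
      by (intro card_mono) auto
    finally show False
      using t \<open>t > 0\<close> by simp
  qed
next
  assume "t \<le> l \<and> survives b t i"
  then have "{1..t} \<subseteq> {k \<in> {1..l}. survives b k i}"
    using survives_antimono[OF _ _ _ assms] by auto
  then have "card {1..t} \<le> games_won l seat b i"
    unfolding games_won_eq_card[OF assms] by (intro card_mono) auto
  then show "t \<le> games_won l seat b i"
    by simp
qed

lemma games_won_cong:
  assumes "\<And>a c. a \<in> players \<Longrightarrow> c \<in> players \<Longrightarrow> a \<noteq> c \<Longrightarrow> b a c = b' a c"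
  shows "games_won l seat b i = games_won l seat b' i"
  unfolding games_won_def
  by (rule arg_cong[where f = card]) (use survivor_cong[OF assms] in auto)

text \<open>
  The possible results of all duels between two players.  Entries that do not describe a duel are set
  to \<open>False\<close>, so that there are only finitely many tables.
\<close>

definition tables :: "(nat \<Rightarrow> nat \<Rightarrow> bool) set" where
  "tables = {b. (\<forall>a c. b a c \<longrightarrow> a \<in> players \<and> c \<in> players \<and> a \<noteq> c) \<and>
     (\<forall>a\<in>players. \<forall>c\<in>players. a \<noteq> c \<longrightarrow> b c a = (\<not> b a c))}"

lemma tables_entry: "b \<in> tables \<Longrightarrow> b a c \<Longrightarrow> a \<in> players \<and> c \<in> players \<and> a \<noteq> c"
  unfolding tables_def by blast

lemma tables_swap:
  "b \<in> tables \<Longrightarrow> a \<in> players \<Longrightarrow> c \<in> players \<Longrightarrow> a \<noteq> c \<Longrightarrow> b c a \<longleftrightarrow> \<not> b a c"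
  unfolding tables_def by blast

lemma finite_tables: "finite tables"
proof (rule finite_subset)
  show "tables \<subseteq> (\<lambda>R a c. (a, c) \<in> R) ` Pow (players \<times> players)"
  proof
    fix b assume "b \<in> tables"
    then have "{(a, c). b a c} \<in> Pow (players \<times> players)" "b = (\<lambda>a c. (a, c) \<in> {(a, c). b a c})"
      using tables_entry by fast+
    then show "b \<in> (\<lambda>R a c. (a, c) \<in> R) ` Pow (players \<times> players)"
      by blast
  qed
qed simp

section \<open>Reversing one match\<close>

text \<open>
  The transposition of the two players who meet in match \<open>m\<close> of round \<open>Suc k\<close>.
\<close>

definition finalists_swap :: "nat \<Rightarrow> nat \<Rightarrow> (nat \<Rightarrow> nat \<Rightarrow> bool) \<Rightarrow> nat \<Rightarrow> nat" where
  "finalists_swap k m b =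
     Transposition.transpose (survivor seat b k (2 * m - 1)) (survivor seat b k (2 * m))"

text \<open>
  The table in which match \<open>m\<close> of round \<open>Suc k\<close> is reversed while the winner's side of every other
  match of the bracket is kept: the new winner inherits all later results of the old one.  Duels inside
  a block of level \<open>k\<close> must not change, since they decide who meets in the match; and a duel that the
  transposition would move into such a block is left alone as well, which makes the
  operation an involution.
\<close>

definition reverse_match :: "nat \<Rightarrow> nat \<Rightarrow> (nat \<Rightarrow> nat \<Rightarrow> bool) \<Rightarrow> nat \<Rightarrow> nat \<Rightarrow> bool" where
  "reverse_match k m b a c =
     (let \<sigma> = finalists_swap k m b
      in if block k a \<noteq> block k c \<and> block k (\<sigma> a) \<noteq> block k (\<sigma> c) then b (\<sigma> a) (\<sigma> c) else b a c)"

context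
  fixes k m :: nat
  assumes k: "Suc k \<le> l" and m: "m \<in> {1..2 ^ (l - Suc k)}"
begin

lemma finalists_swap_involutory [simp]: "finalists_swap k m b (finalists_swap k m b a) = a"
  by (simp add: finalists_swap_def)

lemma finalists_swap_eq_iff [simp]:
  "finalists_swap k m b a = finalists_swap k m b c \<longleftrightarrow> a = c"
  by (metis finalists_swap_involutory)

lemma finalists_swap_in_players [simp]: "finalists_swap k m b a \<in> players \<longleftrightarrow> a \<in> players"
proof -
  note r = children_in_range[OF k m]
  have "survivor seat b k (2 * m - 1) \<in> players" "survivor seat b k (2 * m) \<in> players"
    using k r survivor_in_players by simp_all
  then show ?thesis
    unfolding finalists_swap_def Transposition.transpose_def by (simp del: atLeastAtMost_iff)
qed

lemma block_finalists:
  "block k (survivor seat b k (2 * m - 1)) = 2 * m - 1" "block k (survivor seat b k (2 * m)) = 2 * m"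
  using children_in_range[OF k m] k by (simp_all add: block_survivor)

lemma block_Suc_finalists:
  "block (Suc k) (survivor seat b k (2 * m - 1)) = m" "block (Suc k) (survivor seat b k (2 * m)) = m"
  using m by (auto intro!: block_Suc_eqI simp: block_finalists simp del: One_nat_def)

lemma finalists_swap_other: "block (Suc k) a \<noteq> m \<Longrightarrow> finalists_swap k m b a = a"
  using block_Suc_finalists unfolding finalists_swap_def by (metis transpose_apply_other)

lemma block_finalists_swap:
  assumes "Suc k \<le> k'"
  shows "block k' (finalists_swap k m b a) = block k' a"
proof -
  have "block (Suc k) (finalists_swap k m b a) = block (Suc k) a"
    using block_Suc_finalists by (auto simp: finalists_swap_def Transposition.transpose_def)
  then show ?thesis
    using assms by (rule block_mono_eq)
qed

lemma reverse_match_in_tables: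
  assumes b: "b \<in> tables"
  shows "reverse_match k m b \<in> tables"
  unfolding tables_def
proof (intro CollectI conjI ballI allI impI)
  fix a c
  assume "reverse_match k m b a c"
  then have "b a c \<or> b (finalists_swap k m b a) (finalists_swap k m b c)"
    by (auto simp: reverse_match_def Let_def split: if_splits)
  then show "a \<in> players" "c \<in> players" "a \<noteq> c"
    using tables_entry[OF b] by (metis finalists_swap_in_players finalists_swap_eq_iff)+
next
  fix a c
  assume ac: "a \<in> players" "c \<in> players" "a \<noteq> c"
  let ?s = "finalists_swap k m b"
  have "b (?s c) (?s a) = (\<not> b (?s a) (?s c))" "b c a = (\<not> b a c)"
    using ac by (metis tables_swap[OF b] finalists_swap_in_players finalists_swap_eq_iff)+
  then show "reverse_match k m b c a = (\<not> reverse_match k m b a c)"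
    unfolding reverse_match_def Let_def by metis
qed

lemma survivor_reverse_match_early:
  assumes "k' \<le> k" "m' \<in> {1..2 ^ (l - k')}"
  shows "survivor seat (reverse_match k m b) k' m' = survivor seat b k' m'"
  using assms
proof (induction k' arbitrary: m')
  case (Suc k')
  have le: "Suc k' \<le> l" "k' \<le> l"
    using Suc.prems k by simp_all
  note r = children_in_range[OF le(1) Suc.prems(2)]
  let ?x = "survivor seat b k' (2 * m' - 1)" and ?y = "survivor seat b k' (2 * m')"
  have "block k' ?x = 2 * m' - 1" "block k' ?y = 2 * m'"
    using r le by (simp_all add: block_survivor)
  then have "block (Suc k') ?x = block (Suc k') ?y"
    using Suc.prems unfolding block_Suc by simp presburger
  then have "block k ?x = block k ?y"
    using block_mono_eq Suc.prems by blast
  then have "reverse_match k m b ?x ?y = b ?x ?y"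
    by (simp add: reverse_match_def)
  then show ?case
    using Suc r by (simp add: Let_def)
qed simp

lemma finalists_swap_reverse_match:
  "finalists_swap k m (reverse_match k m b) = finalists_swap k m b"
  using children_in_range[OF k m] by (simp add: finalists_swap_def survivor_reverse_match_early)

lemma reverse_match_involutory: "reverse_match k m (reverse_match k m b) = b"
proof (intro ext)
  fix a c
  let ?s = "finalists_swap k m b"
  have "reverse_match k m (reverse_match k m b) a c =
      (if block k a \<noteq> block k c \<and> block k (?s a) \<noteq> block k (?s c)
       then reverse_match k m b (?s a) (?s c) else reverse_match k m b a c)"
    by (subst reverse_match_def) (simp only: finalists_swap_reverse_match Let_def)
  also have "\<dots> = b a c"
    by (simp add: reverse_match_def Let_def)
  finally show "reverse_match k m (reverse_match k m b) a c = b a c" .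
qed

text \<open>
  From the reversed match on, the bracket is the old one with the two players exchanged; outside the
  part of the bracket above the match the transposition acts trivially.
\<close>

lemma survivor_reverse_match_late:
  assumes b: "b \<in> tables" and "Suc k \<le> k'" "k' \<le> l" "m' \<in> {1..2 ^ (l - k')}"
  shows "survivor seat (reverse_match k m b) k' m' = finalists_swap k m b (survivor seat b k' m')"
  using assms(2-4)
proof (induction k' arbitrary: m' rule: dec_induct)
  case base
  note r = children_in_range[OF base]
  let ?x = "survivor seat b k (2 * m' - 1)" and ?y = "survivor seat b k (2 * m')"
  let ?s = "finalists_swap k m b"
  have xy: "?x \<in> players" "?y \<in> players" and bl: "block k ?x = 2 * m' - 1" "block k ?y = 2 * m'"
    using r base survivor_in_block by simp_all
  have ne: "2 * m' - 1 \<noteq> 2 * m'"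
    using base by auto
  have eq: "survivor seat (reverse_match k m b) (Suc k) m' = (if reverse_match k m b ?x ?y then ?x else ?y)"
    using r by (simp add: Let_def survivor_reverse_match_early)
  show ?case
  proof (cases "m' = m")
    case True
    then have "?s ?x = ?y" "?s ?y = ?x"
      by (simp_all add: finalists_swap_def)
    moreover from this have "reverse_match k m b ?x ?y = b ?y ?x"
      using bl ne by (simp add: reverse_match_def)
    moreover have "?x \<noteq> ?y"
      using bl ne by metis
    then have "b ?y ?x = (\<not> b ?x ?y)"
      by (rule tables_swap[OF b xy])
    ultimately show ?thesis
      unfolding eq by (simp add: Let_def)
  next
    case False
    have "block (Suc k) ?x = m'" "block (Suc k) ?y = m'"
      using bl base(2) by (auto intro!: block_Suc_eqI)
    then have "?s ?x = ?x" "?s ?y = ?y"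
      using False by (simp_all add: finalists_swap_other)
    moreover from this have "reverse_match k m b ?x ?y = b ?x ?y"
      by (auto simp: reverse_match_def)
    ultimately show ?thesis
      unfolding eq by (simp add: Let_def)
  qed
next
  case (step k')
  note r = children_in_range[OF step.prems]
  let ?x = "survivor seat b k' (2 * m' - 1)" and ?y = "survivor seat b k' (2 * m')"
  let ?s = "finalists_swap k m b"
  have ne: "block k' ?x \<noteq> block k' ?y"
    by (rule siblings_distinct[OF step.prems])
  then have "block k ?x \<noteq> block k ?y"
    using block_mono_eq step.hyps(1) by (meson Suc_leD)
  moreover have "block k (?s ?x) \<noteq> block k (?s ?y)"
    using ne block_mono_eq[of k "?s ?x" "?s ?y" k'] step.hyps(1)
    by (auto simp: block_finalists_swap)
  ultimately have "reverse_match k m b (?s ?x) (?s ?y) = b ?x ?y"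
    by (simp add: reverse_match_def)
  then show ?case
    using step.IH[OF _ r(1)] step.IH[OF _ r(2)] step.prems by (simp add: Let_def)
qed

lemma survives_reverse_match_early:
  assumes "k' \<le> k" "i \<in> players"
  shows "survives (reverse_match k m b) k' i \<longleftrightarrow> survives b k' i"
  using assms k block_in_range[OF assms(2), of k']
  by (simp add: survives_def survivor_reverse_match_early)

lemma survives_reverse_match_late:
  assumes "b \<in> tables" "Suc k \<le> k'" "k' \<le> l" "i \<in> players"
  shows "survives (reverse_match k m b) k' i \<longleftrightarrow> survives b k' (finalists_swap k m b i)"
proof -
  have "survivor seat (reverse_match k m b) k' (block k' i) =
      finalists_swap k m b (survivor seat b k' (block k' i))"
    using assms block_in_range[OF assms(4), of k'] by (intro survivor_reverse_match_late) auto
  then show ?thesis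
    unfolding survives_def block_finalists_swap[OF assms(2)]
    by (metis finalists_swap_involutory)
qed

lemma survives_reverse_match_iff:
  assumes b: "b \<in> tables" and j: "j \<in> players" "block (Suc k) j = m" "survives b k j"
  shows "survives (reverse_match k m b) (Suc k) j \<longleftrightarrow> \<not> survives b (Suc k) j"
proof -
  let ?x = "survivor seat b k (2 * m - 1)" and ?y = "survivor seat b k (2 * m)"
  let ?s = "finalists_swap k m b"
  have "?x \<noteq> ?y"
    using siblings_distinct[OF k m] by metis
  moreover have "j = ?x \<or> j = ?y"
    using j block_children[of k j] unfolding survives_def by metis
  ultimately have "?s j \<noteq> j" "{j, ?s j} = {?x, ?y}"
    by (auto simp: finalists_swap_def)
  moreover have "survivor seat b (Suc k) m \<in> {?x, ?y}"
    by (simp add: Let_def)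
  ultimately have "survivor seat b (Suc k) m = ?s j \<longleftrightarrow> survivor seat b (Suc k) m \<noteq> j"
    by auto
  moreover have "survives (reverse_match k m b) (Suc k) j \<longleftrightarrow> survives b (Suc k) (?s j)"
    using survives_reverse_match_late[OF b order_refl k j(1)] .
  ultimately show ?thesis
    unfolding survives_def using block_finalists_swap[of "Suc k" b j] j(2) by simp
qed

text \<open>The only player who can suffer from the reversal is the former winner of the match.\<close>

lemma games_won_reverse_match_ge:
  assumes b: "b \<in> tables" and j: "block (Suc k) j = m" "survives b (Suc k) j"
    and i: "i \<in> players" "i \<noteq> j"
  shows "games_won l seat b i \<le> games_won l seat (reverse_match k m b) i"
proof -
  define t where "t = games_won l seat b i"
  have t: "t \<le> l" "survives b t i"
    using le_games_won_iff[OF i(1), of t b] by (simp_all add: t_def)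
  have "survives (reverse_match k m b) t i"
  proof (cases "t \<le> k")
    case True
    then show ?thesis
      using t(2) survives_reverse_match_early i(1) by blast
  next
    case False
    then have "survives b (Suc k) i"
      using survives_antimono[OF t(2) _ t(1) i(1)] by simp
    then have "block (Suc k) i \<noteq> m"
      using j i(2) unfolding survives_def by metis
    then show ?thesis
      using survives_reverse_match_late[OF b _ t(1) i(1)] False t(2)
      by (simp add: finalists_swap_other)
  qed
  then show ?thesis
    using le_games_won_iff[OF i(1), of t] t(1) by (simp add: t_def)
qed

end

section \<open>Averages over tables\<close>

text \<open>The tables in which every player \<open>j \<in> J\<close> wins at least \<open>t j\<close> games.\<close>

definition outcomes :: "nat set \<Rightarrow> (nat \<Rightarrow> nat) \<Rightarrow> (nat \<Rightarrow> nat \<Rightarrow> bool) set" where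
  "outcomes J t = {b \<in> tables. \<forall>j\<in>J. t j \<le> games_won l seat b j}"

lemma finite_outcomes: "finite (outcomes J t)"
  using finite_tables by (simp add: outcomes_def)

text \<open>
  Requiring one more win of player \<open>j\<close> halves the set of admissible tables: reversing the match in which
  this win takes place exchanges the two halves.  That the larger set of requirements is satisfiable is
  essential, since otherwise the opponent in that match may be forced to win it.
\<close>

lemma bij_betw_reverse_match:
  fixes j :: nat
  defines "T \<equiv> \<lambda>t. reverse_match (t j) (block (Suc (t j)) j)"
  assumes J: "J \<subseteq> players" "j \<in> J" and ne: "outcomes J (t(j := Suc (t j))) \<noteq> {}"
  shows "bij_betw (T t) (outcomes J (t(j := Suc (t j)))) (outcomes J t - outcomes J (t(j := Suc (t j))))"
proof -
  let ?t' = "t(j := Suc (t j))" and ?k = "t j"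
  let ?m = "block (Suc ?k) j"
  have j: "j \<in> players"
    using J by blast
  obtain b0 where b0: "b0 \<in> outcomes J ?t'"
    using ne by blast
  then have "Suc ?k \<le> games_won l seat b0 j"
    using J(2) by (force simp: outcomes_def)
  then have k: "Suc ?k \<le> l" and b0j: "survives b0 (Suc ?k) j"
    unfolding le_games_won_iff[OF j] by simp_all
  have m: "?m \<in> {1..2 ^ (l - Suc ?k)}"
    by (rule block_in_range[OF j k])
  note early = survives_reverse_match_early[OF k m]
  note flip = survives_reverse_match_iff[OF k m _ j refl]
  have 1: "T t b \<in> outcomes J t - outcomes J ?t'" if b: "b \<in> outcomes J ?t'" for b
  proof -
    have bt: "b \<in> tables" and bJ: "\<And>i. i \<in> J \<Longrightarrow> ?t' i \<le> games_won l seat b i"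
      using b by (auto simp: outcomes_def)
    have bj: "survives b (Suc ?k) j"
      using bJ[OF J(2)] le_games_won_iff[OF j] by simp
    then have bj': "survives b ?k j"
      using survives_Suc_imp k j by blast
    have "\<not> survives (T t b) (Suc ?k) j"
      using flip[OF bt bj'] bj by (simp add: T_def)
    then have "T t b \<notin> outcomes J ?t'"
      using J(2) le_games_won_iff[OF j, of "Suc ?k"] by (force simp: outcomes_def)
    moreover have "t i \<le> games_won l seat (T t b) i" if i: "i \<in> J" for i
    proof (cases "i = j")
      case True
      then show ?thesis
        using early[OF order_refl j] bj' k le_games_won_iff[OF j] by (simp add: T_def)
    next
      case False
      then have "t i \<le> games_won l seat b i"
        using bJ[OF i] by simp
      also have "\<dots> \<le> games_won l seat (T t b) i"
        unfolding T_def using games_won_reverse_match_ge[OF k m bt refl bj] i J(1) False by blast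
      finally show ?thesis .
    qed
    ultimately show ?thesis
      using reverse_match_in_tables[OF k m bt] by (simp add: outcomes_def T_def)
  qed
  have 2: "T t b \<in> outcomes J ?t'" if b: "b \<in> outcomes J t - outcomes J ?t'" for b
  proof -
    have bt: "b \<in> tables" and bJ: "\<And>i. i \<in> J \<Longrightarrow> t i \<le> games_won l seat b i"
      using b by (auto simp: outcomes_def)
    have bj: "survives b ?k j"
      using bJ[OF J(2)] le_games_won_iff[OF j] by simp
    have "\<not> Suc ?k \<le> games_won l seat b j"
      using b by (auto simp: outcomes_def split: if_splits)
    then have "\<not> survives b (Suc ?k) j"
      using le_games_won_iff[OF j] k by simp
    then have Tj: "survives (T t b) (Suc ?k) j"
      using flip[OF bt bj] by (simp add: T_def)
    have "?t' i \<le> games_won l seat (T t b) i" if i: "i \<in> J" for i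
    proof (cases "i = j")
      case True
      then show ?thesis
        using Tj k le_games_won_iff[OF j] by simp
    next
      case False
      have i': "i \<in> players"
        using i J(1) by blast
      have ti: "t i \<le> l" "survives b (t i) i"
        using bJ[OF i] le_games_won_iff[OF i'] by simp_all
      have "survives (T t b) (t i) i"
      proof (cases "t i \<le> ?k")
        case True
        then show ?thesis
          using ti early[OF True i'] by (simp add: T_def)
      next
        case gt: False
        have "t i \<le> games_won l seat b0 i"
          using b0 i False by (force simp: outcomes_def)
        then have "survives b0 (t i) i"
          using le_games_won_iff[OF i'] by simp
        then have "survives b0 (Suc ?k) i"
          using survives_antimono[OF _ _ ti(1) i'] gt by simp
        \<comment> \<open>two players cannot both leave the same block alive, so \<open>i\<close> does not take part in the match\<close>
        then have "block (Suc ?k) i \<noteq> ?m"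
          using b0j False unfolding survives_def by metis
        then show ?thesis
          using survives_reverse_match_late[OF k m bt _ ti(1) i'] gt ti(2)
          by (simp add: T_def finalists_swap_other[OF k m])
      qed
      then show ?thesis
        using False ti(1) le_games_won_iff[OF i'] by simp
    qed
    then show ?thesis
      using reverse_match_in_tables[OF k m bt] by (simp add: outcomes_def T_def)
  qed
  show ?thesis
    by (rule bij_betwI[where g = "T t"])
      (use 1 2 reverse_match_involutory[OF k m] in \<open>auto simp: T_def\<close>)
qed

text \<open>The mean of \<open>g\<close> under the uniform distribution on \<open>A\<close>.\<close>

definition average :: "((nat \<Rightarrow> nat \<Rightarrow> bool) \<Rightarrow> real) \<Rightarrow> (nat \<Rightarrow> nat \<Rightarrow> bool) set \<Rightarrow> real" where
  "average g A = (\<Sum>b\<in>A. g b) / real (card A)"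

lemma average_outcomes_step:
  assumes J: "J \<subseteq> players" "j \<in> J" and ne: "outcomes J (t(j := Suc (t j))) \<noteq> {}"
    and g: "\<And>b b'. (\<And>i. i \<in> players \<Longrightarrow> i \<noteq> j \<Longrightarrow> games_won l seat b i \<le> games_won l seat b' i) \<Longrightarrow> g b \<le> g b'"
  shows "average g (outcomes J (t(j := Suc (t j)))) \<le> average g (outcomes J t)"
proof -
  let ?A = "outcomes J t" and ?A' = "outcomes J (t(j := Suc (t j)))"
  let ?T = "reverse_match (t j) (block (Suc (t j)) j)"
  note bij = bij_betw_reverse_match[OF J ne]
  have "t i \<le> (t(j := Suc (t j))) i" for i
    by simp
  then have sub: "?A' \<subseteq> ?A"
    unfolding outcomes_def by (blast intro: order_trans)
  have j: "j \<in> players"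
    using J by blast
  have le: "g b \<le> g (?T b)" if b: "b \<in> ?A'" for b
  proof (rule g)
    fix i assume i: "i \<in> players" "i \<noteq> j"
    have "Suc (t j) \<le> games_won l seat b j" and bt: "b \<in> tables"
      using b J(2) by (force simp: outcomes_def)+
    then have k: "Suc (t j) \<le> l" and bj: "survives b (Suc (t j)) j"
      unfolding le_games_won_iff[OF j] by simp_all
    show "games_won l seat b i \<le> games_won l seat (?T b) i"
      by (rule games_won_reverse_match_ge[OF k block_in_range[OF j k] bt refl bj i])
  qed
  have split: "sum h ?A = sum h ?A' + sum (\<lambda>b. h (?T b)) ?A'" for h :: "_ \<Rightarrow> real"
    using sum.subset_diff[OF sub finite_outcomes, of h] sum.reindex_bij_betw[OF bij, of h] by simp
  have "real (card ?A) = 2 * real (card ?A')"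
    using split[of "\<lambda>_. 1"] by simp
  moreover have "2 * sum g ?A' \<le> sum g ?A"
    unfolding split[of g] using sum_mono[of ?A' g "\<lambda>b. g (?T b)"] le by simp
  moreover have "card ?A' > 0"
    using ne finite_outcomes by (simp add: card_gt_0_iff)
  ultimately show ?thesis
    by (simp add: average_def field_simps)
qed

text \<open>
  This is negative right-tail dependence for the uniform distribution on tables.  It suffices to raise
  the requirements one win at a time; all intermediate sets of requirements are satisfiable because the
  final one is.
\<close>

lemma average_outcomes_antimono:
  assumes J: "J \<subseteq> players" and "I \<inter> J = {}" and ne: "outcomes J t' \<noteq> {}"
    and g: "\<And>b b'. (\<And>i. i \<in> I \<Longrightarrow> games_won l seat b i \<le> games_won l seat b' i) \<Longrightarrow> g b \<le> g b'"
    and I: "I \<subseteq> players" and "\<And>j. j \<in> J \<Longrightarrow> t j \<le> t' j"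
  shows "average g (outcomes J t') \<le> average g (outcomes J t)"
  using assms(6)
proof (induction "\<Sum>j\<in>J. t' j - t j" arbitrary: t rule: less_induct)
  case less
  have fin: "finite J"
    using J finite_subset by blast
  show ?case
  proof (cases "\<exists>j\<in>J. t j < t' j")
    case False
    then have "outcomes J t' = outcomes J t"
      using less.prems by (force simp: outcomes_def)
    then show ?thesis
      by simp
  next
    case True
    then obtain j where j: "j \<in> J" "t j < t' j"
      by blast
    let ?t1 = "t(j := Suc (t j))"
    have le: "?t1 i \<le> t' i" if "i \<in> J" for i
      using j less.prems[OF that] by simp
    have "(\<Sum>j\<in>J. t' j - ?t1 j) < (\<Sum>j\<in>J. t' j - t j)"
      by (rule sum_strict_mono_ex1[OF fin]) (use j in auto)
    then have "average g (outcomes J t') \<le> average g (outcomes J ?t1)"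
      using less.hyps le by blast
    also have "\<dots> \<le> average g (outcomes J t)"
    proof (rule average_outcomes_step[OF J j(1)])
      have "outcomes J t' \<subseteq> outcomes J ?t1"
        using le unfolding outcomes_def by (blast intro: order_trans)
      then show "outcomes J ?t1 \<noteq> {}"
        using ne by blast
    next
      fix b b'
      assume *: "\<And>i. i \<in> players \<Longrightarrow> i \<noteq> j \<Longrightarrow> games_won l seat b i \<le> games_won l seat b' i"
      show "g b \<le> g b'"
        by (rule g, rule *) (use I assms(2) j(1) in auto)
    qed
    finally show ?thesis .
  qed
qed

end

section \<open>The law of the outcome table\<close>

lemma (in finite_measure) integral_finite_range:
  fixes h :: "'b \<Rightarrow> real"
  assumes "finite T" and Y: "\<And>\<omega>. \<omega> \<in> space M \<Longrightarrow> Y \<omega> \<in> T"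
    and sets: "\<And>b. b \<in> T \<Longrightarrow> {\<omega> \<in> space M. Y \<omega> = b} \<in> sets M"
  shows "(\<integral>\<omega>. h (Y \<omega>) \<partial>M) = (\<Sum>b\<in>T. h b * measure M {\<omega> \<in> space M. Y \<omega> = b})"
proof -
  have "(\<integral>\<omega>. h (Y \<omega>) \<partial>M) = (\<integral>\<omega>. (\<Sum>b\<in>T. h b * indicator {\<omega> \<in> space M. Y \<omega> = b} \<omega>) \<partial>M)"
  proof (rule Bochner_Integration.integral_cong[OF refl])
    fix \<omega> assume \<omega>: "\<omega> \<in> space M"
    have "(\<Sum>b\<in>T. h b * indicator {\<omega> \<in> space M. Y \<omega> = b} \<omega>) = (\<Sum>b\<in>T. if b = Y \<omega> then h b else 0)"
      using \<omega> by (intro sum.cong) (auto simp: indicator_def)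
    then show "h (Y \<omega>) = (\<Sum>b\<in>T. h b * indicator {\<omega> \<in> space M. Y \<omega> = b} \<omega>)"
      using Y[OF \<omega>] assms(1) by simp
  qed
  also have "\<dots> = (\<Sum>b\<in>T. \<integral>\<omega>. h b * indicator {\<omega> \<in> space M. Y \<omega> = b} \<omega> \<partial>M)"
    using sets emeasure_finite by (intro Bochner_Integration.integral_sum) (simp add: less_top[symmetric])
  also have "\<dots> = (\<Sum>b\<in>T. h b * measure M {\<omega> \<in> space M. Y \<omega> = b})"
  proof (intro sum.cong refl)
    fix b
    have "{\<omega> \<in> space M. Y \<omega> = b} \<inter> space M = {\<omega> \<in> space M. Y \<omega> = b}"
      by blast
    then show "(\<integral>\<omega>. h b * indicator {\<omega> \<in> space M. Y \<omega> = b} \<omega> \<partial>M) = h b * measure M {\<omega> \<in> space M. Y \<omega> = b}"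
      by (simp only: integral_mult_right_zero Bochner_Integration.integral_indicator)
  qed
  finally show ?thesis .
qed

text \<open>A knockout tournament between players of equal strength.\<close>

locale fair_knockout = knockout_tournament +
  assumes fair: "\<And>i j. \<lbrakk>i \<in> {1..2 ^ l}; j \<in> {1..2 ^ l}; i \<noteq> j\<rbrakk> \<Longrightarrow> p i j = 1 / 2"
begin

sublocale bracket l seat
  by unfold_locales (rule seat_bij)

text \<open>The outcome table that is realised at \<open>\<omega>\<close>.\<close>

definition result :: "'a \<Rightarrow> nat \<Rightarrow> nat \<Rightarrow> bool" where
  "result \<omega> a c \<longleftrightarrow> a \<in> players \<and> c \<in> players \<and> a \<noteq> c \<and> beats \<omega> a c"

lemma result_in_tables: "\<omega> \<in> space M \<Longrightarrow> result \<omega> \<in> tables"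
  using beats_swap unfolding tables_def result_def by blast

lemma games_won_result: "games_won l seat (beats \<omega>) i = games_won l seat (result \<omega>) i"
  by (rule games_won_cong) (simp add: result_def)

text \<open>Every unordered pair of players, listed once with the smaller number first.\<close>

definition duels :: "(nat \<times> nat) set" where
  "duels = {(i, j). 1 \<le> i \<and> i < j \<and> j \<le> 2 ^ l}"

lemma finite_duels: "finite duels"
  by (rule finite_subset[of _ "players \<times> players"]) (auto simp: duels_def)

lemma duel_event:
  assumes "i \<in> players" "j \<in> players" "i < j"
  shows "{\<omega> \<in> space M. beats \<omega> i j = v} \<in> events" and "prob {\<omega> \<in> space M. beats \<omega> i j = v} = 1 / 2"
proof -
  have "(i, j) \<in> {(i, j). 1 \<le> i \<and> i < j \<and> j \<le> 2 ^ l}"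
    using assms by auto
  then have "(\<lambda>\<omega>. beats \<omega> i j) \<in> M \<rightarrow>\<^sub>M count_space UNIV"
    using beats_indep unfolding indep_vars_def2 by (auto dest!: bspec[where x = "(i, j)"])
  then have ev: "{\<omega> \<in> space M. beats \<omega> i j = v} \<in> events" for v
    by measurable
  then show "{\<omega> \<in> space M. beats \<omega> i j = v} \<in> events" .
  have T: "prob {\<omega> \<in> space M. beats \<omega> i j} = 1 / 2"
    using beats_prob fair assms by simp
  show "prob {\<omega> \<in> space M. beats \<omega> i j = v} = 1 / 2"
  proof (cases v)
    case True
    then show ?thesis
      using T by simp
  next
    case False
    then show ?thesis
      using T prob_neg[of "\<lambda>\<omega>. beats \<omega> i j"] ev[of True] by simp
  qed
qed

lemma result_eq_iff:
  assumes b: "b \<in> tables" and \<omega>: "\<omega> \<in> space M"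
  shows "result \<omega> = b \<longleftrightarrow> (\<forall>d\<in>duels. beats \<omega> (fst d) (snd d) = b (fst d) (snd d))"
proof
  assume "result \<omega> = b"
  then show "\<forall>d\<in>duels. beats \<omega> (fst d) (snd d) = b (fst d) (snd d)"
    by (auto simp: duels_def result_def)
next
  assume *: "\<forall>d\<in>duels. beats \<omega> (fst d) (snd d) = b (fst d) (snd d)"
  have r: "result \<omega> \<in> tables"
    by (rule result_in_tables[OF \<omega>])
  have lt: "result \<omega> a c = b a c" if "a \<in> players" "c \<in> players" "a < c" for a c
    using bspec[OF *, of "(a, c)"] that by (simp add: duels_def result_def)
  show "result \<omega> = b"
  proof (intro ext)
    fix a c
    consider "a \<notin> players \<or> c \<notin> players \<or> a = c" | "a \<in> players" "c \<in> players" "a < c"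
      | "a \<in> players" "c \<in> players" "c < a"
      by (metis linorder_neqE_nat)
    then show "result \<omega> a c = b a c"
    proof cases
      case 1
      then show ?thesis
        using tables_entry[OF b] tables_entry[OF r] by blast
    next
      case 2
      then show ?thesis
        by (rule lt)
    next
      case 3
      then show ?thesis
        using lt[of c a] tables_swap[OF b, of c a] tables_swap[OF r, of c a] by blast
    qed
  qed
qed

lemma result_law:
  assumes b: "b \<in> tables"
  shows "{\<omega> \<in> space M. result \<omega> = b} \<in> events"
    and "prob {\<omega> \<in> space M. result \<omega> = b} = (1 / 2) ^ card duels"
proof -
  define E where "E = (\<lambda>d. {\<omega> \<in> space M. beats \<omega> (fst d) (snd d) = b (fst d) (snd d)})"
  have E: "E d \<in> events" "prob (E d) = 1 / 2" if "d \<in> duels" for d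
    using that duel_event[of "fst d" "snd d"] by (auto simp: E_def duels_def)
  have eq: "{\<omega> \<in> space M. result \<omega> = b} = {\<omega> \<in> space M. \<forall>d\<in>duels. \<omega> \<in> E d}"
    using result_eq_iff[OF b] by (auto simp: E_def)
  show "{\<omega> \<in> space M. result \<omega> = b} \<in> events"
    unfolding eq
  proof (rule sets.sets_Collect_finite_All[OF _ finite_duels])
    fix d assume "d \<in> duels"
    moreover have "{\<omega> \<in> space M. \<omega> \<in> E d} = E d"
      by (auto simp: E_def)
    ultimately show "{\<omega> \<in> space M. \<omega> \<in> E d} \<in> events"
      using E(1) by simp
  qed
  show "prob {\<omega> \<in> space M. result \<omega> = b} = (1 / 2) ^ card duels"
  proof (cases "duels = {}")
    case True
    then show ?thesis
      unfolding eq by (simp add: prob_space)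
  next
    case False
    let ?X = "\<lambda>(i, j) \<omega>. beats \<omega> i j"
    have pre: "?X d -` {b (fst d) (snd d)} \<inter> space M = E d" for d
      by (auto simp: E_def split: prod.splits)
    have "prob (\<Inter>d\<in>duels. ?X d -` {b (fst d) (snd d)} \<inter> space M) =
        (\<Prod>d\<in>duels. prob (?X d -` {b (fst d) (snd d)} \<inter> space M))"
      by (rule indep_varsD_finite[OF beats_indep[folded duels_def] False finite_duels]) simp
    then have "prob (\<Inter>d\<in>duels. E d) = (\<Prod>d\<in>duels. prob (E d))"
      unfolding pre .
    also have "\<dots> = (1 / 2) ^ card duels"
      by (subst prod.cong[OF refl E(2)]) simp_all
    also have "(\<Inter>d\<in>duels. E d) = {\<omega> \<in> space M. result \<omega> = b}"
      unfolding eq using False by (auto simp: E_def)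
    finally show ?thesis .
  qed
qed

lemma result_event:
  assumes "S \<subseteq> tables"
  shows "{\<omega> \<in> space M. result \<omega> \<in> S} \<in> events"
    and "prob {\<omega> \<in> space M. result \<omega> \<in> S} = real (card S) * (1 / 2) ^ card duels"
proof -
  have fin: "finite S"
    using assms finite_tables finite_subset by blast
  have eq: "{\<omega> \<in> space M. result \<omega> \<in> S} = (\<Union>b\<in>S. {\<omega> \<in> space M. result \<omega> = b})"
    by auto
  have ev: "{\<omega> \<in> space M. result \<omega> = b} \<in> events" if "b \<in> S" for b
    using that assms result_law(1) by blast
  show "{\<omega> \<in> space M. result \<omega> \<in> S} \<in> events"
    unfolding eq using fin ev by (intro sets.finite_UN) auto
  have "prob (\<Union>b\<in>S. {\<omega> \<in> space M. result \<omega> = b}) = (\<Sum>b\<in>S. prob {\<omega> \<in> space M. result \<omega> = b})"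
    by (rule finite_measure_finite_Union[OF fin]) (use ev in \<open>auto simp: disjoint_family_on_def\<close>)
  also have "\<dots> = (\<Sum>b\<in>S. (1 / 2) ^ card duels)"
    using assms result_law(2) by (intro sum.cong) auto
  finally show "prob {\<omega> \<in> space M. result \<omega> \<in> S} = real (card S) * (1 / 2) ^ card duels"
    unfolding eq by simp
qed

text \<open>Conditioned on an event about the table, the table is uniformly distributed on that event.\<close>

lemma integral_uniform_result:
  assumes S: "S \<subseteq> tables" "S \<noteq> {}"
  shows "(\<integral>\<omega>. g (result \<omega>) \<partial>uniform_measure M {\<omega> \<in> space M. result \<omega> \<in> S}) = average g S"
proof -
  let ?A = "{\<omega> \<in> space M. result \<omega> \<in> S}" and ?c = "(1 / 2 :: real) ^ card duels"
  have fin: "finite S"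
    using S finite_tables finite_subset by blast
  then have card: "card S > 0"
    using S(2) by (simp add: card_gt_0_iff)
  have pA: "prob ?A = real (card S) * ?c"
    by (rule result_event(2)[OF S(1)])
  then have A: "emeasure M ?A \<noteq> 0" "emeasure M ?A \<noteq> \<infinity>"
    using card by (auto simp: emeasure_eq_measure)
  interpret U: prob_space "uniform_measure M ?A"
    by (rule prob_space_uniform_measure[OF A])
  have pt: "measure (uniform_measure M ?A) {\<omega> \<in> space M. result \<omega> = b} =
      (if b \<in> S then 1 / real (card S) else 0)" if "b \<in> tables" for b
  proof -
    have "?A \<inter> {\<omega> \<in> space M. result \<omega> = b} = (if b \<in> S then {\<omega> \<in> space M. result \<omega> = b} else {})"
      by auto
    then show ?thesis
      using measure_uniform_measure[OF A result_law(1)[OF that]] result_law(2)[OF that] pA by simp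
  qed
  have "(\<integral>\<omega>. g (result \<omega>) \<partial>uniform_measure M ?A) =
      (\<Sum>b\<in>tables. g b * measure (uniform_measure M ?A) {\<omega> \<in> space M. result \<omega> = b})"
    using U.integral_finite_range[OF finite_tables, of result g] result_in_tables result_law(1) by simp
  also have "\<dots> = (\<Sum>b\<in>tables. if b \<in> S then g b / real (card S) else 0)"
    by (intro sum.cong) (auto simp: pt)
  also have "\<dots> = average g S"
    using sum.inter_restrict[OF finite_tables, of "\<lambda>b. g b / real (card S)" S] S(1)
    by (simp add: average_def Int_absorb1 flip: sum_divide_distrib)
  finally show ?thesis .
qed

section \<open>Negative right-tail dependence of the scores\<close>

text \<open>The number of games won by player \<open>i\<close> as a real random variable.\<close>

definition score :: "nat \<Rightarrow> 'a \<Rightarrow> real" where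
  "score i \<omega> = real (games_won l seat (beats \<omega>) i)"

lemma score_measurable: "score i \<in> borel_measurable M"
proof (rule borel_measurableI)
  fix V :: "real set"
  have "score i -` V \<inter> space M =
      {\<omega> \<in> space M. result \<omega> \<in> {b \<in> tables. real (games_won l seat b i) \<in> V}}"
    using result_in_tables by (auto simp: score_def games_won_result)
  also have "\<dots> \<in> events"
    by (rule result_event(1)) blast
  finally show "score i -` V \<inter> space M \<in> events" .
qed

text \<open>Scores are natural numbers, so a strict real threshold amounts to a required number of wins.\<close>

lemma exceed_score:
  "exceed M J score x = {\<omega> \<in> space M. result \<omega> \<in> outcomes J (\<lambda>j. nat (\<lfloor>x j\<rfloor> + 1))}"
proof -
  have "x j < real n \<longleftrightarrow> nat (\<lfloor>x j\<rfloor> + 1) \<le> n" for j n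
    by linarith
  then show ?thesis
    using result_in_tables by (auto simp: exceed_def outcomes_def score_def games_won_result)
qed

lemma integral_cond_law_score:
  assumes "integrable (cond_law M (exceed M J score x) I score) \<phi>"
    and pos: "prob (exceed M J score x) > 0"
  shows "outcomes J (\<lambda>j. nat (\<lfloor>x j\<rfloor> + 1)) \<noteq> {}"
    and "integral\<^sup>L (cond_law M (exceed M J score x) I score) \<phi> =
      average (\<lambda>b. \<phi> (\<lambda>i\<in>I. real (games_won l seat b i))) (outcomes J (\<lambda>j. nat (\<lfloor>x j\<rfloor> + 1)))"
proof -
  let ?S = "outcomes J (\<lambda>j. nat (\<lfloor>x j\<rfloor> + 1))"
  show ne: "?S \<noteq> {}"
    using pos by (auto simp: exceed_score)
  have S: "?S \<subseteq> tables"
    by (auto simp: outcomes_def)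
  have meas: "(\<lambda>\<omega>. \<lambda>i\<in>I. score i \<omega>) \<in> uniform_measure M (exceed M J score x) \<rightarrow>\<^sub>M PiM I (\<lambda>_. borel)"
    by (rule measurable_restrict) (use score_measurable in simp)
  have "\<phi> \<in> borel_measurable (PiM I (\<lambda>_. borel))"
    using borel_measurable_integrable[OF assms(1)] by (simp add: cond_law_def)
  then have "integral\<^sup>L (cond_law M (exceed M J score x) I score) \<phi> =
      (\<integral>\<omega>. \<phi> (\<lambda>i\<in>I. score i \<omega>) \<partial>uniform_measure M (exceed M J score x))"
    unfolding cond_law_def by (rule integral_distr[OF meas])
  also have "\<dots> = average (\<lambda>b. \<phi> (\<lambda>i\<in>I. real (games_won l seat b i))) ?S"
    using integral_uniform_result[OF S ne, of "\<lambda>b. \<phi> (\<lambda>i\<in>I. real (games_won l seat b i))"]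
    unfolding exceed_score score_def games_won_result .
  finally show "integral\<^sup>L (cond_law M (exceed M J score x) I score) \<phi> =
      average (\<lambda>b. \<phi> (\<lambda>i\<in>I. real (games_won l seat b i))) ?S" .
qed

lemma NRTD_score: "NRTD M players score"
  unfolding NRTD_def
proof (intro conjI ballI allI impI)
  show "score i \<in> borel_measurable M" for i
    by (rule score_measurable)
next
  fix I J :: "nat set" and x x' :: "nat \<Rightarrow> real"
  assume I: "I \<subseteq> players" and J: "J \<subseteq> players" and IJ: "I \<inter> J = {}" and le: "\<forall>j\<in>J. x j \<le> x' j"
    and pos: "0 < prob (exceed M J score x)" and pos': "0 < prob (exceed M J score x')"
  show "st_le I (cond_law M (exceed M J score x') I score) (cond_law M (exceed M J score x) I score)"
    unfolding st_le_def
  proof (intro allI impI)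
    fix \<phi> :: "(nat \<Rightarrow> real) \<Rightarrow> real"
    assume mono: "mono_on (I \<rightarrow>\<^sub>E UNIV) \<phi>"
      and int': "integrable (cond_law M (exceed M J score x') I score) \<phi>"
      and int: "integrable (cond_law M (exceed M J score x) I score) \<phi>"
    let ?g = "\<lambda>b. \<phi> (\<lambda>i\<in>I. real (games_won l seat b i))"
    have "average ?g (outcomes J (\<lambda>j. nat (\<lfloor>x' j\<rfloor> + 1))) \<le> average ?g (outcomes J (\<lambda>j. nat (\<lfloor>x j\<rfloor> + 1)))"
    proof (rule average_outcomes_antimono[OF J IJ integral_cond_law_score(1)[OF int' pos'] _ I])
      fix b b'
      assume "\<And>i. i \<in> I \<Longrightarrow> games_won l seat b i \<le> games_won l seat b' i"
      then show "?g b \<le> ?g b'"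
        by (intro mono_onD[OF mono]) (auto simp: le_fun_def)
    next
      fix j assume "j \<in> J"
      then have "\<lfloor>x j\<rfloor> \<le> \<lfloor>x' j\<rfloor>"
        using le floor_mono by blast
      then show "nat (\<lfloor>x j\<rfloor> + 1) \<le> nat (\<lfloor>x' j\<rfloor> + 1)"
        by simp
    qed
    then show "integral\<^sup>L (cond_law M (exceed M J score x') I score) \<phi> \<le>
        integral\<^sup>L (cond_law M (exceed M J score x) I score) \<phi>"
      using integral_cond_law_score(2)[OF int pos] integral_cond_law_score(2)[OF int' pos'] by simp
  qed
qed

end

theorem theorem3p10:
  fixes M :: "'a measure"
    and l :: nat
    and p :: "nat \<Rightarrow> nat \<Rightarrow> real"
    and seat :: "nat \<Rightarrow> nat"
    and beats :: "'a \<Rightarrow> nat \<Rightarrow> nat \<Rightarrow> bool"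
  assumes "l \<ge> 2"
    and "knockout_tournament M l p seat beats"
    and "\<And>i j. \<lbrakk>i \<in> {1..2 ^ l}; j \<in> {1..2 ^ l}; i \<noteq> j\<rbrakk> \<Longrightarrow> p i j = 1 / 2"
  shows "NRTD M {1..2 ^ l} (\<lambda>i \<omega>. real (games_won l seat (beats \<omega>) i))"
proof -
  interpret T: knockout_tournament M l p seat beats
    by (rule assms(2))
  interpret T: fair_knockout M l p seat beats
    by unfold_locales (rule assms(3))
  show ?thesis
    using T.NRTD_score unfolding T.score_def .
qed

end
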